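(* Let $\alpha>-1$ and $t\in\mathbb{R}$. The sub-leading coefficient $\mathrm{p}(n):=\mathrm{p}(n,t)$ of the monic orthogonal polynomials satisfies, for every integer $n\ge1$, the second-order nonlinear difference equation $$\begin{aligned}&\big(n-2t\,\mathrm{p}(n)+2t\,\mathrm{p}(n+1)\big)^2+2\alpha\big(n-2t\,\mathrm{p}(n)+2t\,\mathrm{p}(n+1)\big)\\&-\big(2n-1+2\alpha-2t\,\mathrm{p}(n-1)+2t\,\mathrm{p}(n+1)\big)\Big[n+2\mathrm{p}(n)+2t\big(\mathrm{p}(n)-\mathrm{p}(n+1)\big)\big(\mathrm{p}(n-1)-\mathrm{p}(n)-1\big)\Big]=0,\end{aligned}$$ with the initial conditions $$\mathrm{p}(1,t)=0,\qquad \mathrm{p}(2,t)=-\frac{\Phi\left(\frac32,\frac52+\alpha;-t\right)}{(3+2\alpha)\,\Phi\left(\frac12,\frac32+\alpha;-t\right)}.$$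
   Context: For $\alpha>-1$ and $t\in\mathbb{R}$ let $w(x,t)=(1-x^2)^{\alpha}e^{-tx^2}$, $x\in[-1,1]$. Let $P_n(x,t)$, $n=0,1,2,\ldots$, be the monic polynomials of degree $n$ orthogonal with respect to $w$: $\int_{-1}^1P_m(x,t)P_n(x,t)w(x,t)\,dx=h_n(t)\delta_{mn}$. Since $w$ is even, $P_n(x,t)=x^n+\mathrm{p}(n,t)x^{n-2}+\cdots$, which defines the sub-leading coefficient $\mathrm{p}(n,t)$ for $n\ge2$; by definition $\mathrm{p}(0,t)=\mathrm{p}(1,t)=0$. $\Phi(a,b;z)=\sum_{k\ge0}\frac{(a)_k}{(b)_k}\frac{z^k}{k!}$ is Kummer's confluent hypergeometric function, where $(a)_0=1$, $(a)_k=a(a+1)\cdots(a+k-1)$. *)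

theory Defs
  imports "HOL-Analysis.Analysis" "HOL-Computational_Algebra.Polynomial"
begin

text \<open>At the endpoints \<open>x = 1\<close> and \<open>x = -1\<close> this has the value \<open>0\<close>, because \<open>0 powr \<alpha> = 0\<close> for
  every \<open>\<alpha>\<close>; this null set does not affect the integrals below.\<close>

definition weight :: "real \<Rightarrow> real \<Rightarrow> real \<Rightarrow> real" where
  "weight \<alpha> t x = (1 - x\<^sup>2) powr \<alpha> * exp (- t * x\<^sup>2)"

text \<open>For \<open>\<alpha> > -1\<close> the weight is Lebesgue integrable on \<open>{-1..1}\<close>, so all integrals below are
  integrals of integrable functions.\<close>

definition monic_orthogonal_polys :: "real \<Rightarrow> real \<Rightarrow> (nat \<Rightarrow> real poly) \<Rightarrow> bool" where
  "monic_orthogonal_polys \<alpha> t P \<longleftrightarrow>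
     (\<forall>n. degree (P n) = n \<and> lead_coeff (P n) = 1) \<and>
     (\<exists>h :: nat \<Rightarrow> real. \<forall>m n.
        (LINT x:{-1..1}|lborel. poly (P m) x * poly (P n) x * weight \<alpha> t x)
          = (if m = n then h n else 0))"

text \<open>Since the weight is even, \<open>P\<^sub>n(x) = x\<^sup>n + p(n) x\<^sup>n\<^sup>-\<^sup>2 + \<dots>\<close>: the sub-leading coefficient is the
  one of \<open>x\<^sup>n\<^sup>-\<^sup>2\<close>, not of \<open>x\<^sup>n\<^sup>-\<^sup>1\<close>.\<close>

definition subleading :: "(nat \<Rightarrow> real poly) \<Rightarrow> nat \<Rightarrow> real" where
  "subleading P n = (if n < 2 then 0 else coeff (P n) (n - 2))"

definition kummer :: "real \<Rightarrow> real \<Rightarrow> real \<Rightarrow> real" where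
  "kummer a b z = (\<Sum>k. pochhammer a k / pochhammer b k * (z ^ k / fact k))"

end

theory Submission
  imports Defs
begin

text \<open>
  Write \<open>L q\<close> for the integral of the polynomial \<open>q\<close> against the weight \<open>w\<close>, and put
  \<open>\<beta>\<^sub>n = p(n) - p(n+1)\<close>. Everything algebraic follows from two facts about \<open>L\<close>.

  Since \<open>w\<close> is even, \<open>P\<^sub>n\<close> has the parity of \<open>n\<close>, and comparing coefficients shows that the
  three-term recurrence is \<open>x P\<^sub>n = P\<^sub>n\<^sub>+\<^sub>1 + \<beta>\<^sub>n P\<^sub>n\<^sub>-\<^sub>1\<close> with this very \<open>\<beta>\<^sub>n\<close>.

  Since \<open>(1 - x\<^sup>2) w\<close> vanishes at the endpoints for every \<open>\<alpha> > -1\<close>, integrating the derivative of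
  \<open>(1 - x\<^sup>2) w q\<close> gives the Pearson identity
  \<open>L ((1 - x\<^sup>2) q' - 2 (\<alpha> + 1) x q - 2 t x (1 - x\<^sup>2) q) = 0\<close>. The choice \<open>q = P\<^sub>n P\<^sub>n\<^sub>-\<^sub>1\<close> turns it
  into the string equation
  \<open>n + 2 p(n) = \<beta>\<^sub>n (2n + 1 + 2\<alpha> + 2t - 2t (\<beta>\<^sub>n\<^sub>+\<^sub>1 + \<beta>\<^sub>n + \<beta>\<^sub>n\<^sub>-\<^sub>1))\<close>
  (\<open>string_equation\<close>), a relation of third order in \<open>p\<close>.

  With \<open>R\<^sub>n = n - 2 t \<beta>\<^sub>n\<close>, the difference of two consecutive string equations, multiplied by
  \<open>R\<^sub>n + R\<^sub>n\<^sub>+\<^sub>1 + 2\<alpha>\<close>, telescopes to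
  \<open>R\<^sub>n (R\<^sub>n + 2\<alpha>) = \<beta>\<^sub>n (R\<^sub>n + R\<^sub>n\<^sub>+\<^sub>1 + 2\<alpha>) (R\<^sub>n\<^sub>-\<^sub>1 + R\<^sub>n + 2\<alpha>)\<close>
  (\<open>quadratic_first_integral\<close>). Here \<open>\<beta>\<^sub>n\<^sub>+\<^sub>1\<close> occurs linearly, in the combination
  \<open>\<beta>\<^sub>n (R\<^sub>n + R\<^sub>n\<^sub>+\<^sub>1 + 2\<alpha>)\<close>, and eliminating it by means of the string equation leaves the
  second-order difference equation.

  For the initial value, \<open>P\<^sub>2 = x\<^sup>2 + p(2)\<close> is orthogonal to \<open>1\<close>, so \<open>p(2) = - L(x\<^sup>2) / L(1)\<close>.
  Expanding \<open>exp (- t x\<^sup>2)\<close> reduces both integrals to the moments of \<open>(1 - x\<^sup>2)\<^sup>\<alpha>\<close>, whose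
  two-term recursion is the Pearson identity at \<open>t = 0\<close>; its solution is a quotient of Pochhammer
  symbols, and the expansions are Kummer series.
\<close>

section \<open>Monic orthogonal polynomials of an even functional\<close>

locale symmetric_orthogonal_polys =
  fixes L :: "real poly \<Rightarrow> real" and P :: "nat \<Rightarrow> real poly"
  assumes L_add: "L (q + r) = L q + L r"
    and L_smult: "L (smult c q) = c * L q"
    and L_square_pos: "q \<noteq> 0 \<Longrightarrow> L (q * q) > 0"
    and L_reflect: "L (pcompose q [:0, -1:]) = L q"
    and degree_P [simp]: "degree (P n) = n"
    and lead_coeff_P: "lead_coeff (P n) = 1"
    and orthogonal: "m \<noteq> n \<Longrightarrow> L (P m * P n) = 0"
begin

abbreviation p :: "nat \<Rightarrow> real" where
  "p \<equiv> subleading P"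

lemma coeff_P_degree [simp]: "coeff (P n) n = 1"
  using lead_coeff_P[of n] by simp

lemma L_0 [simp]: "L 0 = 0"
  using L_smult[of 0 0] by simp

lemma L_diff: "L (q - r) = L q - L r"
  using L_add[of "q - r" r] by simp

definition h :: "nat \<Rightarrow> real" where
  "h n = L (P n * P n)"

definition \<beta> :: "nat \<Rightarrow> real" where
  "\<beta> n = p n - p (n + 1)"

lemma h_pos: "h n > 0"
  unfolding h_def using coeff_P_degree[of n] by (intro L_square_pos) force

text \<open>Monic polynomials of every degree span all polynomials: subtracting the right multiple of
  \<open>P (degree q)\<close> lowers the degree of \<open>q\<close>.\<close>

lemma orthogonal_span:
  assumes "\<And>k. k \<le> degree q \<Longrightarrow> L (r * P k) = 0"
  shows "L (r * q) = 0"
  using assms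
proof (induction "degree q" arbitrary: q rule: less_induct)
  case less
  let ?q = "q - smult (lead_coeff q) (P (degree q))"
  have "?q = 0 \<or> degree ?q < degree q"
    by (intro eq_zero_or_degree_less degree_diff_le) auto
  then have "L (r * ?q) = 0" using less by auto
  then show ?case using less.prems[of "degree q"] by (simp add: L_diff L_smult right_diff_distrib)
qed

text \<open>The integrals below are evaluated by bringing the factor next to \<open>P n\<close> down to degree
  \<open>n\<close>, so that only its top coefficient matters.\<close>

lemma L_mult_P:
  assumes "degree q \<le> n"
  shows "L (q * P n) = coeff q n * h n"
proof -
  define d where "d = q - smult (coeff q n) (P n)"
  have "d = 0 \<or> degree d < n"
    unfolding d_def using assms by (intro eq_zero_or_degree_less degree_diff_le) auto
  then have "L (P n * d) = 0"
    using orthogonal_span[of d "P n"] orthogonal[of n] by fastforce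
  then show ?thesis
    by (simp add: d_def L_diff L_smult right_diff_distrib h_def mult.commute)
qed

lemma L_mult_P_lower_degree: "degree q < n \<Longrightarrow> L (q * P n) = 0"
  by (simp add: L_mult_P coeff_eq_0)

text \<open>Parity. The difference \<open>d\<close> of the two sides has degree below \<open>n\<close>, the leading terms
  cancelling. It is orthogonal to \<open>P n\<close>, and, moving the reflection onto the other factor by
  evenness of \<open>L\<close>, also to the reflected \<open>P n\<close>; hence it is orthogonal to itself.\<close>

lemma pcompose_P: "pcompose (P n) [:0, -1:] = smult ((-1) ^ n) (P n)"
proof -
  let ?r = "[:0, -1:] :: real poly"
  let ?d = "pcompose (P n) ?r - smult ((-1) ^ n) (P n)"
  have "?d = 0 \<or> degree ?d < n"
    by (intro eq_zero_or_degree_less degree_diff_le) (auto simp: degree_pcompose coeff_pcompose_linear)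
  then have "?d = 0"
  proof
    assume deg: "degree ?d < n"
    have "pcompose (pcompose ?d ?r * P n) ?r = pcompose (pcompose ?d ?r) ?r * pcompose (P n) ?r"
      by (simp add: pcompose_mult)
    also have "pcompose (pcompose ?d ?r) ?r = ?d"
      by (simp only: pcompose_assoc [symmetric]) (simp add: pcompose_pCons)
    finally have "L (?d * pcompose (P n) ?r) = L (pcompose ?d ?r * P n)"
      using L_reflect by metis
    also have "\<dots> = 0"
      using deg by (intro L_mult_P_lower_degree) (simp add: degree_pcompose)
    finally have "L (?d * ?d) = 0"
      using L_mult_P_lower_degree[OF deg]
      by (simp only: right_diff_distrib[of ?d "pcompose (P n) ?r"] L_diff mult_smult_right L_smult)
    then show ?thesis using L_square_pos[of ?d] by auto
  qed
  then show ?thesis by simp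
qed

lemma coeff_P_Suc_eq_0 [simp]: "coeff (P (Suc n)) n = 0"
proof -
  have "coeff (pcompose (P (Suc n)) [:0, -1:]) n = (-1) ^ n * coeff (P (Suc n)) n"
    by (simp add: coeff_pcompose_linear)
  then show ?thesis by (simp add: pcompose_P)
qed

lemma coeff_P_Suc_Suc [simp]: "coeff (P (Suc (Suc n))) n = p (Suc (Suc n))"
  by (simp add: subleading_def)

lemma p_0 [simp]: "p 0 = 0" and p_1 [simp]: "p (Suc 0) = 0"
  by (simp_all add: subleading_def)

lemma \<beta>_0 [simp]: "\<beta> 0 = 0"
  by (simp add: \<beta>_def)

text \<open>Multiplication by \<open>x\<close> is \<open>pCons 0\<close>. By parity and the choice of \<open>\<beta> n\<close>, the coefficients
  of \<open>d = x P\<^sub>n - P\<^sub>n\<^sub>+\<^sub>1 - \<beta>\<^sub>n P\<^sub>n\<^sub>-\<^sub>1\<close> vanish down to index \<open>n - 1\<close>. Then \<open>d\<close> is orthogonal to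
  the last two summands, and also to \<open>x P\<^sub>n\<close> because \<open>x d\<close> has degree below \<open>n\<close>; so \<open>d\<close> is
  orthogonal to itself. For \<open>n = 0\<close> the truncated index \<open>n - 1\<close> is harmless because
  \<open>\<beta> 0 = 0\<close>.\<close>

lemma three_term_recurrence: "pCons 0 (P n) = P (n + 1) + smult (\<beta> n) (P (n - 1))"
proof (cases n)
  case 0
  have "pCons 0 (P 0) - P 1 = 0 \<or> degree (pCons 0 (P 0) - P 1) < 1"
    by (intro eq_zero_or_degree_less degree_diff_le) (auto simp: degree_pCons_eq_if)
  then have "pCons 0 (P 0) - P 1 = 0"
    using coeff_P_Suc_eq_0[of 0] by (auto elim!: degree_eq_zeroE simp: poly_eq_iff coeff_pCons split: nat.splits)
  with 0 show ?thesis by simp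
next
  case (Suc m)
  let ?d = "pCons 0 (P (Suc m)) - P (m + 2) - smult (\<beta> (Suc m)) (P m)"
  have "coeff ?d m = 0"
    by (cases m) (auto simp: \<beta>_def)
  moreover have "degree ?d \<le> m"
  proof (rule degree_le, intro allI impI)
    fix i assume "i > m"
    then consider "i = Suc m" | "i = m + 2" | "i > m + 2" by linarith
    then show "coeff ?d i = 0"
      by cases (auto simp: coeff_eq_0 degree_pCons_eq_if coeff_pCons split: nat.splits)
  qed
  ultimately have "?d = 0 \<or> degree ?d < m" by (intro eq_zero_or_degree_less)
  then have "?d = 0"
  proof
    assume deg: "degree ?d < m"
    have "L (?d * pCons 0 (P (Suc m))) = L (pCons 0 ?d * P (Suc m))" by simp
    also have "\<dots> = 0" using deg by (intro L_mult_P_lower_degree) (simp add: degree_pCons_eq_if)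
    finally have "L (?d * ?d) = 0"
      using L_mult_P_lower_degree[OF deg] L_mult_P_lower_degree[of ?d "m + 2"] deg
      by (simp only: right_diff_distrib[of ?d] L_diff mult_smult_right L_smult)
    then show ?thesis using L_square_pos[of ?d] by auto
  qed
  with Suc show ?thesis by (simp add: algebra_simps)
qed

text \<open>The next lemmas compute the four integrals into which the Pearson identity for
  \<open>q = P\<^sub>m\<^sub>+\<^sub>1 P\<^sub>m\<close> splits: those with \<open>x\<close> and \<open>x\<^sup>3\<close>, and those in which either factor is
  differentiated.\<close>

lemma L_x_P_P: "L (pCons 0 (P (Suc m)) * P m) = h (Suc m)"
  using L_mult_P[of "pCons 0 (P m)" "Suc m"] by (simp add: degree_pCons_eq_if mult.commute)

lemma h_Suc: "h (Suc m) = \<beta> (Suc m) * h m"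
  unfolding L_x_P_P[symmetric] three_term_recurrence
  by (simp add: distrib_right L_add L_smult orthogonal h_def)

lemma L_x_cubed_P_P:
  "L (pCons 0 (P (Suc m)) * pCons 0 (pCons 0 (P m)))
    = h (Suc m) * (\<beta> (m + 2) + \<beta> (Suc m) + \<beta> m)"
proof -
  have "pCons 0 (pCons 0 (P m)) = pCons 0 (P (Suc m)) + smult (\<beta> m) (pCons 0 (P (m - 1)))"
    unfolding three_term_recurrence[of m] by simp
  then have "L (pCons 0 (P (Suc m)) * pCons 0 (pCons 0 (P m)))
      = L (pCons 0 (P (Suc m)) * pCons 0 (P (Suc m)))
        + \<beta> m * L (pCons 0 (P (Suc m)) * pCons 0 (P (m - 1)))"
    by (simp only: distrib_left L_add mult_smult_right L_smult)
  also have "L (pCons 0 (P (Suc m)) * pCons 0 (P (Suc m))) = h (m + 2) + (\<beta> (Suc m))\<^sup>2 * h m"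
    unfolding three_term_recurrence[of "Suc m"]
    by (simp add: distrib_left distrib_right L_add L_smult orthogonal h_def power2_eq_square)
  also have "\<dots> = h (Suc m) * (\<beta> (m + 2) + \<beta> (Suc m))"
    using h_Suc[of m] h_Suc[of "Suc m"] by (simp add: algebra_simps power2_eq_square)
  also have "\<beta> m * L (pCons 0 (P (Suc m)) * pCons 0 (P (m - 1))) = \<beta> m * h (Suc m)"
  proof (cases m)
    case (Suc k)
    have "L (pCons 0 (P (Suc m)) * pCons 0 (P (m - 1))) = L (pCons 0 (pCons 0 (P k)) * P (Suc m))"
      using Suc by (simp add: mult.commute)
    also have "\<dots> = h (Suc m)"
      using Suc by (subst L_mult_P) (auto simp: degree_pCons_eq_if)
    finally show ?thesis by simp
  qed simp
  finally show ?thesis by (simp add: algebra_simps)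
qed

lemma L_deriv_lower_times_P:
  "L (([:1, 0, -1:] * pderiv (P m)) * P (Suc m)) = - real m * h (Suc m)"
proof -
  have "degree ([:1, 0, -1:] * pderiv (P m)) \<le> Suc m"
  proof (cases m)
    case 0
    then show ?thesis by (simp add: pderiv_eq_0_iff[THEN iffD2])
  next
    case (Suc k)
    have "degree ([:1, 0, -1:] * pderiv (P m)) \<le> degree [:1, 0, -1::real:] + degree (pderiv (P m))"
      by (rule degree_mult_le)
    then show ?thesis using Suc by (simp add: degree_pderiv)
  qed
  moreover have "coeff ([:1, 0, -1:] * pderiv (P m)) (Suc m) = - real m"
    by (cases m) (auto simp: coeff_pderiv coeff_eq_0)
  ultimately show ?thesis by (simp only: L_mult_P)
qed

text \<open>Here the differentiated factor has the higher degree, so the product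
  \<open>(1 - x\<^sup>2) P\<^sub>m\<^sub>+\<^sub>1'\<close>, of degree \<open>m + 2\<close>, first has to be brought down to degree \<open>m\<close>. By parity
  it suffices to remove its leading term by a multiple of \<open>P\<^sub>m\<^sub>+\<^sub>2\<close>, which is orthogonal to
  \<open>P\<^sub>m\<close>; this is how \<open>p\<close> itself, and not only \<open>\<beta>\<close>, enters the string equation.\<close>

lemma L_deriv_P_times_lower:
  "L (([:1, 0, -1:] * pderiv (P (Suc m))) * P m)
    = (Suc m - (real m - 1) * p (Suc m) + Suc m * p (m + 2)) * h m"
proof -
  let ?q = "[:1, 0, -1:] * pderiv (P (Suc m)) + smult (Suc m) (P (m + 2))"
  have "degree ?q \<le> m"
  proof (rule degree_le, intro allI impI)
    fix i assume "i > m"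
    then consider "i = Suc m" | "i = m + 2" | "i > m + 2" by linarith
    then show "coeff ?q i = 0"
      by cases (auto simp: coeff_eq_0 coeff_pderiv coeff_pCons split: nat.splits)
  qed
  moreover have "coeff ?q m = Suc m - (real m - 1) * p (Suc m) + Suc m * p (m + 2)"
    by (auto simp: coeff_pderiv coeff_pCons split: nat.splits)
  ultimately have "L (?q * P m) = (Suc m - (real m - 1) * p (Suc m) + Suc m * p (m + 2)) * h m"
    by (simp only: L_mult_P)
  then show ?thesis
    by (simp only: distrib_right L_add mult_smult_left L_smult) (simp add: orthogonal)
qed

lemma p_2: "p 2 = - L (monom 1 2) / L 1"
proof -
  have "P 0 = 1" using coeff_P_degree[of 0] degree_P[of 0]
    by (metis degree_eq_zeroE coeff_pCons_0 pCons_one)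
  moreover have "P 2 = monom 1 2 + smult (p 2) 1"
  proof (rule poly_eqI)
    fix k :: nat
    consider "k = 0" | "k = 1" | "k = 2" | "k > 2" by linarith
    then show "coeff (P 2) k = coeff (monom 1 2 + smult (p 2) 1) k"
      using coeff_P_Suc_Suc[of 0] coeff_P_Suc_eq_0[of 1] coeff_P_degree[of 2]
      by cases (auto simp: coeff_eq_0 numeral_2_eq_2 coeff_pCons split: nat.splits)
  qed
  ultimately have "L (P 2 * P 0) = L (monom 1 2) + p 2 * L 1"
    by (simp only: mult_1_right L_add L_smult)
  then have "L (monom 1 2) + p 2 * L 1 = 0"
    using orthogonal[of 2 0] by simp
  moreover have "L 1 > 0" using L_square_pos[of 1] by simp
  ultimately show ?thesis by (simp add: field_simps)
qed

end

section \<open>The difference equation from the Pearson identity\<close>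

locale pearson_orthogonal_polys = symmetric_orthogonal_polys +
  fixes \<alpha> t :: real
  assumes pearson: "L ([:1, 0, -1:] * pderiv q + [:0, - 2 * (\<alpha> + 1 + t), 0, 2 * t:] * q) = 0"
begin

text \<open>The Pearson identity for the product of two consecutive orthogonal polynomials; the common
  factor \<open>h m > 0\<close> cancels.\<close>

lemma string_equation:
  shows "real (Suc m) + 2 * p (Suc m) =
    \<beta> (Suc m) * (2 * real (Suc m) + 1 + 2 * \<alpha> + 2 * t - 2 * t * (\<beta> (m + 2) + \<beta> (Suc m) + \<beta> m))"
proof -
  let ?\<sigma> = "[:1, 0, -1:] :: real poly"
  have "?\<sigma> * pderiv (P (Suc m) * P m) + [:0, - 2 * (\<alpha> + 1 + t), 0, 2 * t:] * (P (Suc m) * P m)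
      = (?\<sigma> * pderiv (P (Suc m))) * P m + (?\<sigma> * pderiv (P m)) * P (Suc m)
        + smult (- 2 * (\<alpha> + 1 + t)) (pCons 0 (P (Suc m)) * P m)
        + smult (2 * t) (pCons 0 (P (Suc m)) * pCons 0 (pCons 0 (P m)))"
    unfolding pderiv_mult by (simp add: algebra_simps)
  then have "0 = L (\<dots>)" using pearson by metis
  also have "\<dots> = (Suc m - (real m - 1) * p (Suc m) + Suc m * p (m + 2)) * h m - real m * h (Suc m)
      - 2 * (\<alpha> + 1 + t) * h (Suc m) + 2 * t * (h (Suc m) * (\<beta> (m + 2) + \<beta> (Suc m) + \<beta> m))"
    by (simp only: L_add L_smult L_deriv_P_times_lower L_deriv_lower_times_P L_x_P_P L_x_cubed_P_P)
  also have "\<dots> = h m * (Suc m + 2 * p (Suc m)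
      - \<beta> (Suc m) * (2 * real (Suc m) + 1 + 2 * \<alpha> + 2 * t - 2 * t * (\<beta> (m + 2) + \<beta> (Suc m) + \<beta> m)))"
    unfolding h_Suc by (simp add: \<beta>_def algebra_simps)
  finally show ?thesis using h_pos[of m] by simp
qed

text \<open>Eliminating \<open>\<beta>\<^sub>m\<^sub>+\<^sub>2\<close> from the string equation requires a second relation between the same
  unknowns, and it arises by summation. Let \<open>S\<^sub>m = R\<^sub>m + R\<^sub>m\<^sub>+\<^sub>1 + 2\<alpha>\<close>. In the difference of two
  consecutive string equations the term \<open>p\<close> becomes \<open>\<beta>\<close>, and the result is
  \<open>R\<^sub>m\<^sub>+\<^sub>2 - R\<^sub>m\<^sub>+\<^sub>1 = \<beta>\<^sub>m\<^sub>+\<^sub>2 S\<^sub>m\<^sub>+\<^sub>2 - \<beta>\<^sub>m\<^sub>+\<^sub>1 S\<^sub>m\<close>. The factor \<open>S\<^sub>m\<^sub>+\<^sub>1\<close> makes the left side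
  the increment of \<open>R (R + 2\<alpha>)\<close> and the right side the increment of
  \<open>\<beta>\<^sub>m\<^sub>+\<^sub>1 S\<^sub>m\<^sub>+\<^sub>1 S\<^sub>m\<close>. The constant of summation is zero because \<open>R\<^sub>0 = 0\<close>.\<close>

lemma quadratic_first_integral:
  defines "R \<equiv> \<lambda>n. real n - 2 * t * \<beta> n"
  shows "R (Suc m) * (R (Suc m) + 2 * \<alpha>)
    = \<beta> (Suc m) * (R (Suc m) + R (m + 2) + 2 * \<alpha>) * (R m + R (Suc m) + 2 * \<alpha>)"
proof (induction m)
  case 0
  have "R 1 = \<beta> 1 * (R 1 + R 2 + 2 * \<alpha>)"
    using string_equation[of 0] unfolding R_def by (simp add: algebra_simps numeral_2_eq_2)
  moreover have "R 0 = 0" by (simp add: R_def)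
  ultimately show ?case by (simp add: numeral_2_eq_2)
next
  case (Suc m)
  have p: "p (Suc m) - p (m + 2) = \<beta> (Suc m)" by (simp add: \<beta>_def)
  have step: "R (m + 2) - R (Suc m) = \<beta> (m + 2) * (R (m + 2) + R (m + 3) + 2 * \<alpha>)
      - \<beta> (Suc m) * (R m + R (Suc m) + 2 * \<alpha>)"
    using string_equation[of m] string_equation[of "Suc m"] p
    unfolding R_def by (simp add: algebra_simps eval_nat_numeral)
  have "R (m + 2) * (R (m + 2) + 2 * \<alpha>)
      = R (Suc m) * (R (Suc m) + 2 * \<alpha>) + (R (m + 2) - R (Suc m)) * (R (Suc m) + R (m + 2) + 2 * \<alpha>)"
    by (simp add: algebra_simps)
  also have "\<dots> = \<beta> (m + 2) * (R (m + 2) + R (m + 3) + 2 * \<alpha>) * (R (Suc m) + R (m + 2) + 2 * \<alpha>)"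
    unfolding Suc.IH step by (simp add: algebra_simps)
  finally show ?case by (simp add: eval_nat_numeral)
qed

theorem subleading_difference_equation:
  assumes "n \<ge> 1"
  shows "(real n - 2 * t * p n + 2 * t * p (n + 1))\<^sup>2
           + 2 * \<alpha> * (real n - 2 * t * p n + 2 * t * p (n + 1))
           - (2 * real n - 1 + 2 * \<alpha> - 2 * t * p (n - 1) + 2 * t * p (n + 1))
             * (real n + 2 * p n + 2 * t * (p n - p (n + 1)) * (p (n - 1) - p n - 1)) = 0"
proof -
  obtain m where n: "n = Suc m" using \<open>n \<ge> 1\<close> by (cases n) auto
  define R where "R n = real n - 2 * t * \<beta> n" for n
  have 1: "real n - 2 * t * p n + 2 * t * p (n + 1) = R n"
    by (simp add: R_def \<beta>_def algebra_simps)
  have 2: "2 * real n - 1 + 2 * \<alpha> - 2 * t * p (n - 1) + 2 * t * p (n + 1) = R m + R (Suc m) + 2 * \<alpha>"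
    by (simp add: R_def \<beta>_def n algebra_simps)
  have "real n + 2 * p n + 2 * t * (p n - p (n + 1)) * (p (n - 1) - p n - 1)
      = real n + 2 * p n + 2 * t * \<beta> (Suc m) * (\<beta> m - 1)"
    by (simp add: \<beta>_def n)
  also have "\<dots> = \<beta> (Suc m) * (R (Suc m) + R (m + 2) + 2 * \<alpha>)"
    using string_equation[of m] unfolding n R_def by (simp add: algebra_simps)
  finally have 3: "real n + 2 * p n + 2 * t * (p n - p (n + 1)) * (p (n - 1) - p n - 1)
      = \<beta> (Suc m) * (R (Suc m) + R (m + 2) + 2 * \<alpha>)" .
  show ?thesis
    unfolding 1 2 3 using quadratic_first_integral[of m]
    unfolding n R_def power2_eq_square by (simp only: algebra_simps)
qed

end

section \<open>Integration against the weight\<close>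

text \<open>The substitution \<open>u = (1 + x) / 2\<close> gives \<open>1 - x\<^sup>2 = 4 u (1 - u)\<close>, which reduces the claim to
  the integrability of the Beta density.\<close>

lemma set_integrable_jacobi:
  fixes \<alpha> :: real
  assumes "\<alpha> > -1"
  shows "set_integrable lborel {-1..1} (\<lambda>x. (1 - x\<^sup>2) powr \<alpha>)"
proof -
  let ?f = "\<lambda>u::real. indicator {0..1} u *\<^sub>R (u powr (\<alpha> + 1 - 1) * (1 - u) powr (\<alpha> + 1 - 1))"
  have "integrable lborel ?f"
    using integrable_Beta[of "\<alpha> + 1" "\<alpha> + 1"] assms unfolding set_integrable_def by simp
  then have "integrable lborel (\<lambda>x. ?f (1/2 + 1/2 * x))"
    by (rule lborel_integrable_real_affine) simp
  then have "integrable lborel (\<lambda>x. 4 powr \<alpha> * ?f (1/2 + 1/2 * x))"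
    by (rule integrable_mult_right)
  moreover have "4 powr \<alpha> * ?f (1/2 + 1/2 * x) = indicator {-1..1} x *\<^sub>R (1 - x\<^sup>2) powr \<alpha>" for x :: real
  proof (cases "x \<in> {-1..1}")
    case True
    then have "4 powr \<alpha> * ((1/2 + 1/2 * x) powr \<alpha> * (1 - (1/2 + 1/2 * x)) powr \<alpha>)
        = (4 * ((1/2 + 1/2 * x) * (1 - (1/2 + 1/2 * x)))) powr \<alpha>"
      by (simp add: powr_mult)
    also have "4 * ((1/2 + 1/2 * x) * (1 - (1/2 + 1/2 * x))) = 1 - x\<^sup>2"
      by (simp add: power2_eq_square field_simps)
    finally show ?thesis using True by (simp add: indicator_def)
  next
    case False
    then have "1/2 + 1/2 * x \<notin> {0..1}" by auto
    with False show ?thesis by (simp only: indicator_simps not_False_eq_True) simp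
  qed
  ultimately show ?thesis unfolding set_integrable_def by (simp only:)
qed

lemma weight_nonneg: "weight \<alpha> t x \<ge> 0"
  by (simp add: weight_def)

lemma weight_pos: "x \<in> {-1<..<1} \<Longrightarrow> weight \<alpha> t x > 0"
  using abs_square_less_1[of x] by (simp add: weight_def abs_less_iff)

lemma borel_measurable_weight [measurable]: "weight \<alpha> t \<in> borel_measurable borel"
  unfolding weight_def by measurable

lemma set_integrable_continuous_weight:
  fixes g :: "real \<Rightarrow> real"
  assumes "\<alpha> > -1" "continuous_on UNIV g"
  shows "set_integrable lborel {-1..1} (\<lambda>x. g x * weight \<alpha> t x)"
proof -
  have "continuous_on {-1..1} (\<lambda>x. g x * exp (- t * x\<^sup>2))"
    using continuous_on_subset[OF assms(2)] by (intro continuous_intros) auto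
  then have "bounded ((\<lambda>x. g x * exp (- t * x\<^sup>2)) ` {-1..1})"
    by (intro compact_imp_bounded compact_continuous_image) auto
  then obtain B where B: "\<And>x. x \<in> {-1..1} \<Longrightarrow> \<bar>g x * exp (- t * x\<^sup>2)\<bar> \<le> B"
    unfolding bounded_iff real_norm_def by (metis imageI)
  have [measurable]: "g \<in> borel_measurable borel"
    using assms(2) by (rule borel_measurable_continuous_onI)
  show ?thesis
  proof (rule set_integrable_bound)
    show "set_integrable lborel {-1..1} (\<lambda>x. B * (1 - x\<^sup>2) powr \<alpha>)"
      using set_integrable_jacobi[OF assms(1)] by simp
    show "set_borel_measurable lborel {-1..1} (\<lambda>x. g x * weight \<alpha> t x)"
      unfolding set_borel_measurable_def by measurable
    show "AE x in lborel. x \<in> {-1..1} \<longrightarrow>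
        norm (g x * weight \<alpha> t x) \<le> norm (B * (1 - x\<^sup>2) powr \<alpha>)"
    proof (intro AE_I2 impI)
      fix x :: real assume x: "x \<in> {-1..1}"
      have "norm (g x * weight \<alpha> t x) = \<bar>g x * exp (- t * x\<^sup>2)\<bar> * (1 - x\<^sup>2) powr \<alpha>"
        by (simp add: weight_def abs_mult)
      also have "\<dots> \<le> B * (1 - x\<^sup>2) powr \<alpha>"
        using B[OF x] by (intro mult_right_mono) auto
      also have "\<dots> \<le> norm (B * (1 - x\<^sup>2) powr \<alpha>)" by simp
      finally show "norm (g x * weight \<alpha> t x) \<le> norm (B * (1 - x\<^sup>2) powr \<alpha>)" .
    qed
  qed
qed

definition weight_functional :: "real \<Rightarrow> real \<Rightarrow> real poly \<Rightarrow> real" where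
  "weight_functional \<alpha> t q = (LINT x:{-1..1}|lborel. poly q x * weight \<alpha> t x)"

lemma set_integrable_poly_weight:
  "\<alpha> > -1 \<Longrightarrow> set_integrable lborel {-1..1} (\<lambda>x. poly q x * weight \<alpha> t x)"
  by (intro set_integrable_continuous_weight continuous_intros)

lemma weight_functional_add:
  assumes "\<alpha> > -1"
  shows "weight_functional \<alpha> t (p + q) = weight_functional \<alpha> t p + weight_functional \<alpha> t q"
  using assms by (simp add: weight_functional_def distrib_right set_integrable_poly_weight)

lemma weight_functional_smult: "weight_functional \<alpha> t (smult c q) = c * weight_functional \<alpha> t q"
  by (simp add: weight_functional_def mult.assoc)

lemma weight_functional_reflect:
  "weight_functional \<alpha> t (pcompose q [:0, -1:]) = weight_functional \<alpha> t q"
proof -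
  have "weight_functional \<alpha> t q = (LINT x:{x. - x \<in> {-1..1::real}}|lborel. poly q (-x) * weight \<alpha> t (-x))"
    unfolding weight_functional_def by (rule set_integral_reflect)
  also have "{x. - x \<in> {-1..1::real}} = {-1..1}" by auto
  finally show ?thesis by (simp add: weight_functional_def poly_pcompose weight_def)
qed

text \<open>If the integral vanished, \<open>q\<close> would vanish almost everywhere on the interval, where the
  weight is positive; but \<open>q\<close> has only finitely many roots.\<close>

lemma weight_functional_square_pos:
  assumes "\<alpha> > -1" "q \<noteq> 0"
  shows "weight_functional \<alpha> t (q * q) > 0"
proof -
  let ?f = "\<lambda>x. indicator {-1..1} x *\<^sub>R (poly (q * q) x * weight \<alpha> t x)"
  have int: "integrable lborel ?f"
    using set_integrable_poly_weight[OF assms(1)] unfolding set_integrable_def .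
  have nonneg: "?f x \<ge> 0" for x by (simp add: weight_nonneg)
  have "integral\<^sup>L lborel ?f \<noteq> 0"
  proof
    assume "integral\<^sup>L lborel ?f = 0"
    then have "AE x in lborel. ?f x = 0"
      using integral_nonneg_eq_0_iff_AE[OF int] nonneg by simp
    moreover have "finite {x. poly q x = 0}" using assms(2) by (rule poly_roots_finite)
    then have "AE x in lborel. x \<notin> {x. poly q x = 0}"
      by (intro AE_not_in) (auto intro: finite_imp_null_set_lborel)
    ultimately have "AE x in lborel. x \<notin> {-1<..<1::real}"
    proof eventually_elim
      case (elim x)
      then show ?case using weight_pos[of x \<alpha> t] by (auto simp: indicator_def)
    qed
    then have "emeasure lborel {-1<..<1::real} = 0"
      by (subst (asm) AE_iff_measurable[of "{-1<..<1::real}"]) auto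
    then show False by (simp add: emeasure_lborel_Ioo)
  qed
  moreover have "integral\<^sup>L lborel ?f \<ge> 0" using nonneg by (intro integral_nonneg_AE) auto
  ultimately show ?thesis
    unfolding weight_functional_def set_lebesgue_integral_def by linarith
qed

text \<open>The integrand is the derivative on \<open>(-1, 1)\<close> of \<open>(1 - x\<^sup>2) w q\<close>, which is continuous on the
  closed interval and vanishes at both ends because \<open>\<alpha> + 1 > 0\<close>. For \<open>\<alpha> < 0\<close> the weight is
  unbounded, so the fundamental theorem is needed in the form that asks for the derivative in the
  interior only.\<close>

lemma weight_functional_pearson:
  assumes "\<alpha> > -1"
  shows "weight_functional \<alpha> t
    ([:1, 0, -1:] * pderiv q + [:0, - 2 * (\<alpha> + 1 + t), 0, 2 * t:] * q) = 0"
proof -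
  let ?r = "[:1, 0, -1:] * pderiv q + [:0, - 2 * (\<alpha> + 1 + t), 0, 2 * t:] * q"
  let ?F = "\<lambda>x. (1 - x\<^sup>2) powr (\<alpha> + 1) * exp (- t * x\<^sup>2) * poly q x"
  have "((\<lambda>x. poly ?r x * weight \<alpha> t x) has_integral (?F 1 - ?F (-1))) {-1..1}"
  proof (rule fundamental_theorem_of_calculus_interior)
    show "continuous_on {-1..1} ?F"
      using assms by (intro continuous_on_mult continuous_on_powr' continuous_intros)
        (auto simp: abs_square_le_1 abs_le_iff)
    fix x :: real assume "x \<in> {-1<..<1}"
    then have pos: "1 - x\<^sup>2 > 0" by (simp add: abs_square_less_1 abs_less_iff)
    then have powr: "(1 - x\<^sup>2) powr (\<alpha> + 1) = (1 - x\<^sup>2) * (1 - x\<^sup>2) powr \<alpha>"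
      by (simp add: powr_add)
    have "(?F has_real_derivative
        ((\<alpha> + 1) * (1 - x\<^sup>2) powr \<alpha> * (- 2 * x)) * exp (- t * x\<^sup>2) * poly q x
        + (1 - x\<^sup>2) powr (\<alpha> + 1) * (exp (- t * x\<^sup>2) * (- 2 * t * x)) * poly q x
        + (1 - x\<^sup>2) powr (\<alpha> + 1) * exp (- t * x\<^sup>2) * poly (pderiv q) x) (at x)"
      using pos by (auto intro!: derivative_eq_intros simp: algebra_simps)
    also have "((\<alpha> + 1) * (1 - x\<^sup>2) powr \<alpha> * (- 2 * x)) * exp (- t * x\<^sup>2) * poly q x
        + (1 - x\<^sup>2) powr (\<alpha> + 1) * (exp (- t * x\<^sup>2) * (- 2 * t * x)) * poly q x
        + (1 - x\<^sup>2) powr (\<alpha> + 1) * exp (- t * x\<^sup>2) * poly (pderiv q) x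
        = poly ?r x * weight \<alpha> t x"
      unfolding powr weight_def by (simp add: algebra_simps power2_eq_square)
    finally show "(?F has_vector_derivative poly ?r x * weight \<alpha> t x) (at x)"
      by (simp add: has_real_derivative_iff_has_vector_derivative)
  qed simp
  then have "integral {-1..1} (\<lambda>x. poly ?r x * weight \<alpha> t x) = 0"
    by (simp add: integral_unique)
  then show ?thesis
    unfolding weight_functional_def
    using set_borel_integral_eq_integral(2)[OF set_integrable_poly_weight[OF assms]] by metis
qed

section \<open>Moments and Kummer functions\<close>

text \<open>The Pearson identity for \<open>t = 0\<close> and \<open>q = x\<^sup>2\<^sup>k\<^sup>+\<^sup>1\<close> relates consecutive even moments:
  \<open>(2k + 1) M\<^sub>k = (2k + 3 + 2\<alpha>) M\<^sub>k\<^sub>+\<^sub>1\<close>.\<close>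

lemma jacobi_moment:
  assumes "\<alpha> > -1"
  shows "weight_functional \<alpha> 0 (monom 1 (2 * k)) =
    weight_functional \<alpha> 0 1 * (pochhammer (1/2) k / pochhammer (3/2 + \<alpha>) k)"
proof (induction k)
  case (Suc k)
  let ?M = "\<lambda>k. weight_functional \<alpha> 0 (monom 1 (2 * k))"
  have "[:1, 0, -1:] * pderiv (monom 1 (2 * k + 1)) + [:0, - 2 * (\<alpha> + 1 + 0), 0, 2 * 0:] * monom 1 (2 * k + 1)
      = smult (2 * k + 1) (monom 1 (2 * k)) + smult (- (2 * k + 3 + 2 * \<alpha>)) (monom 1 (2 * Suc k))"
    by (subst poly_eq_poly_eq_iff [symmetric], rule ext)
      (simp add: poly_monom pderiv_monom algebra_simps power2_eq_square)
  then have "(2 * k + 1) * ?M k - (2 * k + 3 + 2 * \<alpha>) * ?M (Suc k) = 0"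
    using weight_functional_pearson[OF assms, of 0 "monom 1 (2 * k + 1)"]
    by (simp only: weight_functional_add[OF assms] weight_functional_smult)
  moreover have "2 * k + 3 + 2 * \<alpha> > 0" using assms by simp
  ultimately have "?M (Suc k) = ?M k * ((1/2 + k) / (3/2 + \<alpha> + k))"
    by (simp add: field_simps)
  then show ?case using Suc.IH by (simp add: pochhammer_Suc)
qed simp

text \<open>Termwise integration of the exponential series is justified by the integrable bound
  \<open>\<bar>t\<bar>\<^sup>k / k! \<sqdot> (1 - x\<^sup>2)\<^sup>\<alpha>\<close> for the \<open>k\<close>-th term, since \<open>\<bar>x\<bar> \<le> 1\<close>.\<close>

lemma weight_functional_even_monom_sums:
  assumes "\<alpha> > -1"
  shows "(\<lambda>k. weight_functional \<alpha> 0 (monom 1 (2 * (k + m))) * ((- t) ^ k / fact k))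
    sums weight_functional \<alpha> t (monom 1 (2 * m))"
proof -
  let ?f = "\<lambda>k x. indicator {-1..1} x *\<^sub>R (x ^ (2 * (k + m)) * ((- t) ^ k / fact k) * weight \<alpha> 0 x)"
  have set_int: "set_integrable lborel {-1..1} (\<lambda>x. x ^ (2 * (k + m)) * ((- t) ^ k / fact k) * weight \<alpha> 0 x)" for k
    using assms by (intro set_integrable_continuous_weight continuous_intros)
  then have int: "integrable lborel (?f k)" for k
    unfolding set_integrable_def .
  have int0: "integrable lborel (\<lambda>x. indicator {-1..1} x *\<^sub>R weight \<alpha> 0 x)"
    using set_integrable_continuous_weight[OF assms, of "\<lambda>_. 1" 0] unfolding set_integrable_def by simp
  have sums_exp: "(\<lambda>k. x ^ (2 * (k + m)) * ((- t) ^ k / fact k) * weight \<alpha> 0 x)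
      sums (x ^ (2 * m) * weight \<alpha> t x)" for x
  proof -
    have "(\<lambda>k. (x ^ (2 * m) * weight \<alpha> 0 x) * ((- t * x\<^sup>2) ^ k /\<^sub>R fact k))
        sums ((x ^ (2 * m) * weight \<alpha> 0 x) * exp (- t * x\<^sup>2))"
      by (intro sums_mult exp_converges)
    moreover have "x ^ (2 * m) * weight \<alpha> 0 x * ((- t * x\<^sup>2) ^ k /\<^sub>R fact k)
        = x ^ (2 * (k + m)) * ((- t) ^ k / fact k) * weight \<alpha> 0 x" for k
      unfolding power_mult_distrib power_add distrib_left power_mult [symmetric]
      by (simp add: divide_inverse mult_ac)
    ultimately show ?thesis by (simp add: weight_def mult_ac)
  qed
  have bound: "norm (?f k x) \<le> \<bar>t\<bar> ^ k / fact k * (indicator {-1..1} x *\<^sub>R weight \<alpha> 0 x)" for k x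
  proof (cases "x \<in> {-1..1}")
    case True
    then have "\<bar>x ^ (2 * (k + m))\<bar> \<le> 1" by (auto simp: power_abs intro!: power_le_one)
    then have "\<bar>x ^ (2 * (k + m))\<bar> * (\<bar>t\<bar> ^ k / fact k * weight \<alpha> 0 x) \<le> 1 * (\<bar>t\<bar> ^ k / fact k * weight \<alpha> 0 x)"
      by (intro mult_right_mono) (auto simp: weight_nonneg)
    then show ?thesis using True by (simp add: abs_mult power_abs weight_nonneg)
  qed simp
  have summable_exp: "summable (\<lambda>k. \<bar>t\<bar> ^ k / fact k * c)" for c
    using summable_mult2[OF summable_exp_generic[of "\<bar>t\<bar>"], of c] by (simp add: field_simps)
  have "(\<lambda>k. integral\<^sup>L lborel (?f k)) sums (\<integral>x. (\<Sum>k. ?f k x) \<partial>lborel)"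
  proof (rule sums_integral)
    show "AE x in lborel. summable (\<lambda>k. norm (?f k x))"
      by (intro AE_I2 summable_comparison_test'[OF summable_exp]) (use bound in auto)
    show "summable (\<lambda>k. \<integral>x. norm (?f k x) \<partial>lborel)"
    proof (rule summable_comparison_test'[OF summable_exp])
      fix k :: nat assume "k \<ge> 0"
      have "(\<integral>x. norm (?f k x) \<partial>lborel) \<le> (\<integral>x. \<bar>t\<bar> ^ k / fact k * (indicator {-1..1} x *\<^sub>R weight \<alpha> 0 x) \<partial>lborel)"
        using int int0 bound by (intro integral_mono integrable_norm integrable_mult_right) auto
      then show "norm (\<integral>x. norm (?f k x) \<partial>lborel) \<le> \<bar>t\<bar> ^ k / fact k * (\<integral>x. indicator {-1..1} x *\<^sub>R weight \<alpha> 0 x \<partial>lborel)"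
        by simp
    qed
  qed (rule int)
  moreover have "(\<Sum>k. ?f k x) = indicator {-1..1} x *\<^sub>R (x ^ (2 * m) * weight \<alpha> t x)" for x
    using sums_unique[OF sums_exp[of x]] by (simp add: indicator_def)
  moreover have "integral\<^sup>L lborel (?f k) = weight_functional \<alpha> 0 (monom 1 (2 * (k + m))) * ((- t) ^ k / fact k)" for k
    unfolding weight_functional_def set_lebesgue_integral_def
    by (subst integral_mult_left_zero [symmetric]) (simp add: poly_monom mult_ac)
  ultimately show ?thesis
    by (simp add: weight_functional_def set_lebesgue_integral_def poly_monom)
qed

lemma weight_functional_1_kummer:
  assumes "\<alpha> > -1"
  shows "weight_functional \<alpha> t 1 = weight_functional \<alpha> 0 1 * kummer (1/2) (3/2 + \<alpha>) (- t)"
proof -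
  let ?c = "\<lambda>k. pochhammer (1/2) k / pochhammer (3/2 + \<alpha>) k * ((- t) ^ k / fact k)"
  have M0: "weight_functional \<alpha> 0 1 \<noteq> 0"
    using weight_functional_square_pos[OF assms, of 1 0] by simp
  have "weight_functional \<alpha> 0 (monom 1 (2 * (k + 0))) * ((- t) ^ k / fact k)
      = weight_functional \<alpha> 0 1 * ?c k" for k
    by (simp add: jacobi_moment[OF assms] mult.assoc)
  then have "(\<lambda>k. weight_functional \<alpha> 0 1 * ?c k) sums weight_functional \<alpha> t 1"
    using weight_functional_even_monom_sums[OF assms, of 0 t] by simp
  then have "?c sums (weight_functional \<alpha> t 1 / weight_functional \<alpha> 0 1)"
    using M0 by (simp add: sums_mult_D sums_mult_iff)
  then have "weight_functional \<alpha> t 1 / weight_functional \<alpha> 0 1 = kummer (1/2) (3/2 + \<alpha>) (- t)"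
    unfolding kummer_def by (rule sums_unique)
  then show ?thesis using M0 by (metis nonzero_divide_eq_eq mult.commute)
qed

text \<open>The shifted moments produce the Kummer series with both parameters raised by one, because
  \<open>(a)\<^sub>k\<^sub>+\<^sub>1 = a (a + 1)\<^sub>k\<close>; the quotient of the two split-off factors is
  \<open>(1/2) / (3/2 + \<alpha>) = 1 / (3 + 2\<alpha>)\<close>.\<close>

lemma weight_functional_x2_kummer:
  assumes "\<alpha> > -1"
  shows "weight_functional \<alpha> t (monom 1 2)
    = weight_functional \<alpha> 0 1 / (3 + 2 * \<alpha>) * kummer (3/2) (5/2 + \<alpha>) (- t)"
proof -
  let ?c = "\<lambda>k. pochhammer (3/2) k / pochhammer (5/2 + \<alpha>) k * ((- t) ^ k / fact k)"
  let ?C = "weight_functional \<alpha> 0 1 / (3 + 2 * \<alpha>)"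
  have C: "?C \<noteq> 0"
    using weight_functional_square_pos[OF assms, of 1 0] assms by simp
  have "weight_functional \<alpha> 0 (monom 1 (2 * (k + 1))) * ((- t) ^ k / fact k) = ?C * ?c k" for k
  proof -
    have "pochhammer (1/2) (k + 1) / pochhammer (3/2 + \<alpha>) (k + 1)
        = (1/2 / (3/2 + \<alpha>)) * (pochhammer (3/2) k / pochhammer (5/2 + \<alpha>) k)"
      by (simp add: pochhammer_rec add.commute add.left_commute)
    also have "1/2 / (3/2 + \<alpha>) = 1 / (3 + 2 * \<alpha>)" using assms by (simp add: field_simps)
    finally show ?thesis
      unfolding jacobi_moment[OF assms] by simp
  qed
  then have "(\<lambda>k. ?C * ?c k) sums weight_functional \<alpha> t (monom 1 2)"
    using weight_functional_even_monom_sums[OF assms, of 1 t] by simp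
  then have "?c sums (weight_functional \<alpha> t (monom 1 2) / ?C)"
    using C sums_mult_iff[of ?C ?c "weight_functional \<alpha> t (monom 1 2) / ?C"] by simp
  then have "weight_functional \<alpha> t (monom 1 2) / ?C = kummer (3/2) (5/2 + \<alpha>) (- t)"
    unfolding kummer_def by (rule sums_unique)
  then show ?thesis using C by (metis nonzero_divide_eq_eq mult.commute)
qed

section \<open>The difference equation for the sub-leading coefficient\<close>

theorem theorem2p4:
  fixes \<alpha> t :: real and P :: "nat \<Rightarrow> real poly" and p :: "nat \<Rightarrow> real"
  assumes "\<alpha> > -1"
    and "monic_orthogonal_polys \<alpha> t P"
    and "p = subleading P"
  shows "(\<forall>n\<ge>1.
           (real n - 2 * t * p n + 2 * t * p (n + 1))\<^sup>2
           + 2 * \<alpha> * (real n - 2 * t * p n + 2 * t * p (n + 1))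
           - (2 * real n - 1 + 2 * \<alpha> - 2 * t * p (n - 1) + 2 * t * p (n + 1))
             * (real n + 2 * p n + 2 * t * (p n - p (n + 1)) * (p (n - 1) - p n - 1)) = 0)
         \<and> p 1 = 0
         \<and> p 2 = - (kummer (3/2) (5/2 + \<alpha>) (- t)
                    / ((3 + 2 * \<alpha>) * kummer (1/2) (3/2 + \<alpha>) (- t)))"
proof -
  interpret pearson_orthogonal_polys "weight_functional \<alpha> t" P \<alpha> t
  proof
    show "weight_functional \<alpha> t (q + r) = weight_functional \<alpha> t q + weight_functional \<alpha> t r" for q r
      using assms(1) by (rule weight_functional_add)
    show "weight_functional \<alpha> t (smult c q) = c * weight_functional \<alpha> t q" for c q
      by (rule weight_functional_smult)
    show "weight_functional \<alpha> t (q * q) > 0" if "q \<noteq> 0" for q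
      using assms(1) that by (rule weight_functional_square_pos)
    show "weight_functional \<alpha> t (pcompose q [:0, -1:]) = weight_functional \<alpha> t q" for q
      by (rule weight_functional_reflect)
    show "degree (P n) = n" "lead_coeff (P n) = 1" for n
      using assms(2) unfolding monic_orthogonal_polys_def by blast+
    show "weight_functional \<alpha> t (P m * P n) = 0" if "m \<noteq> n" for m n
      using assms(2) that by (auto simp: monic_orthogonal_polys_def weight_functional_def)
    show "weight_functional \<alpha> t
        ([:1, 0, -1:] * pderiv q + [:0, - 2 * (\<alpha> + 1 + t), 0, 2 * t:] * q) = 0" for q
      using assms(1) by (rule weight_functional_pearson)
  qed
  have "weight_functional \<alpha> 0 1 > 0"
    using weight_functional_square_pos[OF assms(1), of 1 0] by simp
  then have "subleading P 2 = - (kummer (3/2) (5/2 + \<alpha>) (- t)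
      / ((3 + 2 * \<alpha>) * kummer (1/2) (3/2 + \<alpha>) (- t)))"
    using weight_functional_1_kummer[OF assms(1), of t] weight_functional_x2_kummer[OF assms(1), of t]
    by (simp add: p_2)
  then show ?thesis
    using subleading_difference_equation unfolding assms(3) by simp
qed

end
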